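(* Let $N\ge3$ be an integer and $p\ge q>0$ with $pq>1$. Let $(u_1,u_2)$ be any radial solution of the system $-\Delta u_1=|\nabla u_2|^p$, $-\Delta u_2=|\nabla u_1|^q$. At any point $r$ where $u_1'(r)\ne0$ and $u_2'(r)\ne0$, define $$S=r\frac{|u_2'|^p}{u_1'},\qquad Z=-r\frac{|u_1'|^q}{u_2'},\qquad t=\ln r .$$ Then the radial system $$-\Bigl(u_1''+\frac{N-1}{r}u_1'\Bigr)=|u_2'|^p,\qquad -\Bigl(u_2''+\frac{N-1}{r}u_2'\Bigr)=|u_1'|^q$$ is equivalent to the system $$\begin{cases}S_t=S\,(N-(N-1)p+S+pZ),\\ Z_t=Z\,(N-(N-1)q-qS-Z),\end{cases}$$ and $u_1',u_2'$ are recovered from $r,S,Z$ by $$u_1'=\bigl(r^{-(p+1)}|S||Z|^p\bigr)^{\frac1{pq-1}}\,\mathrm{sign}\,S,\qquad u_2'=-\bigl(r^{-(q+1)}|S|^q|Z|\bigr)^{\frac1{pq-1}}\,\mathrm{sign}\,Z .$$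
   Context: Here $r=|x|$, $'=d/dr$, the subscript $t$ denotes $d/dt$, and $u_1,u_2$ are of class $C^2$ functions of $r$ on an interval of $(0,\infty)$, with no condition of sign. *)

theory Defs
  imports "HOL-Analysis.Analysis"
begin

definition C2_on :: "(real \<Rightarrow> real) \<Rightarrow> real set \<Rightarrow> bool" where
  "C2_on u I \<longleftrightarrow>
     (\<forall>r\<in>I. u differentiable (at r)) \<and>
     (\<forall>r\<in>I. deriv u differentiable (at r)) \<and>
     continuous_on I (deriv (deriv u))"

definition partial_deriv :: "'a::euclidean_space \<Rightarrow> ('a \<Rightarrow> real) \<Rightarrow> 'a \<Rightarrow> real" where
  "partial_deriv b U x = deriv (\<lambda>s. U (x + s *\<^sub>R b)) 0"

definition laplacian :: "('a::euclidean_space \<Rightarrow> real) \<Rightarrow> 'a \<Rightarrow> real" where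
  "laplacian U x = (\<Sum>b\<in>Basis. partial_deriv b (partial_deriv b U) x)"

definition gradient :: "('a::euclidean_space \<Rightarrow> real) \<Rightarrow> 'a \<Rightarrow> 'a" where
  "gradient U x = (THE D. GDERIV U x :> D)"

(* Regularity is not built in: this is meant for functions that are C^2 on \<Omega>,
   where the derivatives above exist. Since 0 powr p = 0, a vanishing gradient
   contributes 0, as it should for p, q > 0. *)
definition gradient_system ::
  "real \<Rightarrow> real \<Rightarrow> 'a::euclidean_space set \<Rightarrow> ('a \<Rightarrow> real) \<Rightarrow> ('a \<Rightarrow> real) \<Rightarrow> bool" where
  "gradient_system p q \<Omega> U1 U2 \<longleftrightarrow>
     (\<forall>x\<in>\<Omega>. - laplacian U1 x = norm (gradient U2 x) powr p \<and>
            - laplacian U2 x = norm (gradient U1 x) powr q)"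

definition radial_system_at ::
  "nat \<Rightarrow> real \<Rightarrow> real \<Rightarrow> (real \<Rightarrow> real) \<Rightarrow> (real \<Rightarrow> real) \<Rightarrow> real \<Rightarrow> bool" where
  "radial_system_at N p q u1 u2 r \<longleftrightarrow>
     - (deriv (deriv u1) r + (real N - 1) / r * deriv u1 r) = \<bar>deriv u2 r\<bar> powr p \<and>
     - (deriv (deriv u2) r + (real N - 1) / r * deriv u2 r) = \<bar>deriv u1 r\<bar> powr q"

definition S_of :: "real \<Rightarrow> (real \<Rightarrow> real) \<Rightarrow> (real \<Rightarrow> real) \<Rightarrow> real \<Rightarrow> real" where
  "S_of p u1 u2 r = r * (\<bar>deriv u2 r\<bar> powr p / deriv u1 r)"

definition Z_of :: "real \<Rightarrow> (real \<Rightarrow> real) \<Rightarrow> (real \<Rightarrow> real) \<Rightarrow> real \<Rightarrow> real" where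
  "Z_of q u1 u2 r = - r * (\<bar>deriv u1 r\<bar> powr q / deriv u2 r)"

(* Here S and Z are functions of t = ln r. *)
definition SZ_system_at ::
  "nat \<Rightarrow> real \<Rightarrow> real \<Rightarrow> (real \<Rightarrow> real) \<Rightarrow> (real \<Rightarrow> real) \<Rightarrow> real \<Rightarrow> bool" where
  "SZ_system_at N p q S Z t \<longleftrightarrow>
     (S has_real_derivative S t * (real N - (real N - 1) * p + S t + p * Z t)) (at t) \<and>
     (Z has_real_derivative Z t * (real N - (real N - 1) * q - q * S t - Z t)) (at t)"

(* The values of u1' and u2' at r, expressed through the values s of S and z of Z. *)
definition du1_of :: "real \<Rightarrow> real \<Rightarrow> real \<Rightarrow> real \<Rightarrow> real \<Rightarrow> real" where
  "du1_of p q r s z =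
     (r powr (- (p + 1)) * \<bar>s\<bar> * \<bar>z\<bar> powr p) powr (1 / (p * q - 1)) * sgn s"

definition du2_of :: "real \<Rightarrow> real \<Rightarrow> real \<Rightarrow> real \<Rightarrow> real \<Rightarrow> real" where
  "du2_of p q r s z =
     - ((r powr (- (q + 1)) * \<bar>s\<bar> powr q * \<bar>z\<bar>) powr (1 / (p * q - 1)) * sgn z)"

end

theory Submission imports Defs begin

text \<open>Three observations carry the theorem.

  First, for a radial function \<open>U(x) = u(|x|)\<close> the gradient has norm \<open>|u'|\<close> and the Laplacian is
  \<open>u'' + (N - 1)/r u'\<close>.  Hence the system of partial differential equations at \<open>x\<close> is the radial
  system at \<open>r = |x|\<close> (\<open>gradient_system_radial\<close>).

  Second, put \<open>a = r u1''/u1'\<close> and \<open>b = r u2''/u2'\<close>.  Since \<open>|S|\<close> and \<open>|Z|\<close> are products of powers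
  of \<open>r\<close>, \<open>|u1'|\<close> and \<open>|u2'|\<close>, their logarithmic derivatives in \<open>t = ln r\<close> are \<open>1 + p b - a\<close> and
  \<open>1 + q a - b\<close>, whatever \<open>u1\<close> and \<open>u2\<close> are.  Division by \<open>u1'\<close> and \<open>u2'\<close> turns the radial
  equations into \<open>a = 1 - N - S\<close> and \<open>b = 1 - N + Z\<close>.  Inserting these gives the system for \<open>S\<close>
  and \<open>Z\<close>; conversely, that system determines \<open>a\<close> and \<open>b\<close>, because the passage from \<open>(a, b)\<close> to
  the two logarithmic derivatives is invertible when \<open>p q \<noteq> 1\<close>
  (\<open>radial_system_iff_SZ_system\<close>).

  Third, for fixed \<open>r\<close> the map from \<open>(u1', u2')\<close> to \<open>(S, Z)\<close> is, up to signs, linear in the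
  logarithms of the moduli, again with determinant \<open>1 - p q\<close>.  The formulas for \<open>u1'\<close> and \<open>u2'\<close>
  are its inverse (\<open>du1_of_recovers\<close>, \<open>S_recovered\<close>, \<open>Z_recovered\<close>).  Given a solution
  \<open>(S, Z)\<close> without zeros, they define two functions whose antiderivatives have the prescribed \<open>S\<close>
  and \<open>Z\<close>, and these solve the radial system by the second point (\<open>SZ_system_reconstruct\<close>).

  Exchanging \<open>u1\<close> with \<open>u2\<close> and \<open>p\<close> with \<open>q\<close> turns \<open>(S, Z)\<close> into \<open>(-Z, -S)\<close>.  By this symmetry
  most computations are done for \<open>S\<close> or \<open>u1'\<close> only.\<close>

section \<open>Radial functions\<close>

lemma GDERIV_radial:
  fixes x :: "'a::euclidean_space"
  assumes "x \<noteq> 0" "(f has_real_derivative d) (at (norm x))"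
  shows "GDERIV (\<lambda>y. f (norm y)) x :> d *\<^sub>R sgn x"
  using GDERIV_DERIV_compose[OF GDERIV_norm] assms by blast

lemma gradient_eqI:
  assumes "GDERIV U x :> D"
  shows "gradient U x = D"
  unfolding gradient_def
proof (rule the_equality)
  show "GDERIV U x :> D" by fact
  fix D' assume "GDERIV U x :> D'"
  then have "(\<lambda>h. inner h D') = (\<lambda>h. inner h D)"
    using assms unfolding gderiv_def by (rule has_derivative_unique)
  then show "D' = D" by (metis vector_eq_ldot)
qed

lemma partial_deriv_GDERIV:
  assumes "GDERIV U x :> D"
  shows "((\<lambda>s. U (x + s *\<^sub>R b)) has_real_derivative inner b D) (at 0)"
    and "partial_deriv b U x = inner b D"
proof -
  have "((\<lambda>s::real. x + s *\<^sub>R b) has_derivative (\<lambda>h. h *\<^sub>R b)) (at 0)"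
    by (auto intro!: derivative_eq_intros)
  moreover have "(U has_derivative (\<lambda>h. inner h D)) (at (x + 0 *\<^sub>R b))"
    using assms by (simp add: gderiv_def)
  ultimately have "((\<lambda>s. U (x + s *\<^sub>R b)) has_derivative (\<lambda>h. inner (h *\<^sub>R b) D)) (at 0)"
    by (rule has_derivative_compose)
  then show "((\<lambda>s. U (x + s *\<^sub>R b)) has_real_derivative inner b D) (at 0)"
    unfolding has_field_derivative_def by (rule has_derivative_eq_rhs) auto
  then show "partial_deriv b U x = inner b D"
    unfolding partial_deriv_def by (rule DERIV_imp_deriv)
qed

text \<open>Along a basis vector \<^term>\<open>b\<close> the first derivative of \<open>u(|y|)\<close> is \<open>(u'(|y|)/|y|) (b \<bullet> y)\<close>, the
  product of a radial function and a linear one.  Differentiating it once more along \<^term>\<open>b\<close> and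
  summing with \<open>\<Sum> (b \<bullet> x)\<^sup>2 = |x|\<^sup>2\<close> gives the radial form of the Laplacian.\<close>

lemma laplacian_radial:
  fixes x :: "'a::euclidean_space"
  assumes I: "open I" "I \<subseteq> {0<..}" "norm x \<in> I" and u: "C2_on u I"
  shows "laplacian (\<lambda>y. u (norm y)) x =
    deriv (deriv u) (norm x) + (real DIM('a) - 1) / norm x * deriv u (norm x)"
proof -
  define r where "r = norm x"
  have r: "r > 0" "r \<in> I" using I by (auto simp: r_def)
  then have x0: "x \<noteq> 0" by (auto simp: r_def)
  define c where "c = (r * deriv (deriv u) r - deriv u r) / r^2"
  have D1: "(u has_real_derivative deriv u \<rho>) (at \<rho>)" if "\<rho> \<in> I" for \<rho>
    using u that by (auto simp: C2_on_def DERIV_deriv_iff_real_differentiable)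
  have D2: "(deriv u has_real_derivative deriv (deriv u) r) (at r)"
    using u r by (auto simp: C2_on_def DERIV_deriv_iff_real_differentiable)
  have first: "partial_deriv b (\<lambda>y. u (norm y)) y = deriv u (norm y) / norm y * inner b y"
    if "norm y \<in> I" for b y :: 'a
  proof -
    have "y \<noteq> 0" using that I by auto
    from partial_deriv_GDERIV(2)[OF GDERIV_radial[OF this D1[OF that]]]
    show ?thesis by (simp add: sgn_div_norm field_simps)
  qed
  have second: "partial_deriv b (partial_deriv b (\<lambda>y. u (norm y))) x =
      c / r * (inner b x)^2 + deriv u r / r" if "b \<in> Basis" for b
  proof -
    have "((\<lambda>\<rho>. deriv u \<rho> / \<rho>) has_real_derivative c) (at (norm x))"
      using r D2 unfolding c_def r_def
      by (auto intro!: derivative_eq_intros simp: field_simps power2_eq_square)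
    from partial_deriv_GDERIV(1)[OF GDERIV_radial[OF x0 this], of b]
    have "((\<lambda>s. deriv u (norm (x + s *\<^sub>R b)) / norm (x + s *\<^sub>R b))
        has_real_derivative c / r * inner b x) (at 0)"
      by (simp add: sgn_div_norm r_def field_simps)
    moreover have "((\<lambda>s. inner b (x + s *\<^sub>R b)) has_real_derivative 1) (at 0)"
      using that by (auto simp: inner_add_right intro!: derivative_eq_intros)
    ultimately have "((\<lambda>s. deriv u (norm (x + s *\<^sub>R b)) / norm (x + s *\<^sub>R b) * inner b (x + s *\<^sub>R b))
        has_real_derivative c / r * (inner b x)^2 + deriv u r / r) (at 0)"
      by (rule DERIV_cong[OF DERIV_mult]) (simp add: r_def power2_eq_square)
    moreover have "open ((\<lambda>s. norm (x + s *\<^sub>R b)) -` I)"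
      by (intro open_vimage I continuous_intros)
    ultimately have "((\<lambda>s. partial_deriv b (\<lambda>y. u (norm y)) (x + s *\<^sub>R b))
        has_real_derivative c / r * (inner b x)^2 + deriv u r / r) (at 0)"
      by (rule has_field_derivative_transform_within_open) (use I first in auto)
    then show ?thesis
      unfolding partial_deriv_def[of b "partial_deriv b _"] by (rule DERIV_imp_deriv)
  qed
  have "(\<Sum>b\<in>Basis. (inner b x)^2) = r^2"
    using euclidean_inner[of x x]
    by (simp add: r_def power2_norm_eq_inner inner_commute) (simp add: power2_eq_square)
  then have "(\<Sum>b\<in>Basis. c / r * (inner b x)^2) = c / r * r^2"
    by (simp only: sum_distrib_left[symmetric])
  then have "laplacian (\<lambda>y. u (norm y)) x = c / r * r^2 + real DIM('a) * (deriv u r / r)"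
    by (simp only: laplacian_def second sum.distrib sum_constant cong: sum.cong)
  moreover have "c * r^2 = r * deriv (deriv u) r - deriv u r"
    using r by (simp add: c_def)
  ultimately show ?thesis
    using r by (simp add: field_simps flip: r_def)
qed

text \<open>Every radius in \<^term>\<open>I\<close> is the norm of some vector, so nothing is lost in passing to the
  radial system.\<close>

lemma gradient_system_radial:
  assumes I: "open I" "I \<subseteq> {0<..}" and u: "C2_on u1 I" "C2_on u2 I"
  shows "gradient_system p q {x::'a::euclidean_space. norm x \<in> I}
      (\<lambda>x. u1 (norm x)) (\<lambda>x. u2 (norm x))
    \<longleftrightarrow> (\<forall>r\<in>I. radial_system_at DIM('a) p q u1 u2 r)"
proof -
  have grad: "norm (gradient (\<lambda>y. u (norm y)) x) = \<bar>deriv u (norm x)\<bar>"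
    if "C2_on u I" "norm x \<in> I" for u and x :: 'a
  proof -
    have "x \<noteq> 0" using that I by auto
    moreover have "(u has_real_derivative deriv u (norm x)) (at (norm x))"
      using that by (auto simp: C2_on_def DERIV_deriv_iff_real_differentiable)
    ultimately show ?thesis
      using gradient_eqI[OF GDERIV_radial, of x u "deriv u (norm x)"] by (simp add: norm_sgn)
  qed
  have "gradient_system p q {x::'a. norm x \<in> I} (\<lambda>x. u1 (norm x)) (\<lambda>x. u2 (norm x))
    \<longleftrightarrow> (\<forall>x::'a. norm x \<in> I \<longrightarrow> radial_system_at DIM('a) p q u1 u2 (norm x))"
    using grad laplacian_radial[OF I, where 'a='a] u
    by (auto simp: gradient_system_def radial_system_at_def)
  also have "\<dots> \<longleftrightarrow> (\<forall>r\<in>I. radial_system_at DIM('a) p q u1 u2 r)"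
  proof -
    have "\<exists>x::'a. norm x = r" if "r \<in> I" for r
      using vector_choose_size[of r] that I by (metis greaterThan_iff less_imp_le subsetD)
    then show ?thesis by metis
  qed
  finally show ?thesis .
qed

section \<open>The system for S and Z\<close>

lemma has_real_derivative_sgn_nonzero:
  assumes "(x::real) \<noteq> 0"
  shows "(sgn has_real_derivative 0) (at x)"
proof (cases "x > 0")
  case True
  have "((\<lambda>_. 1) has_real_derivative 0) (at x)" by simp
  then show ?thesis
    by (rule has_field_derivative_transform_within_open[where S="{0<..}"]) (use True in auto)
next
  case False
  have "((\<lambda>_. -1) has_real_derivative 0) (at x)" by simp
  then show ?thesis
    by (rule has_field_derivative_transform_within_open[where S="{..<0}"])
      (use False assms in auto)
qed

lemma has_real_derivative_abs_powr:
  assumes f: "(f has_real_derivative d) (at x)" and "f x \<noteq> 0"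
  shows "((\<lambda>y. \<bar>f y\<bar> powr p) has_real_derivative \<bar>f x\<bar> powr p * (p * (d / f x))) (at x)"
proof -
  have "((\<lambda>y. sgn (f y)) has_real_derivative 0) (at x)"
    using DERIV_chain2[OF has_real_derivative_sgn_nonzero f] assms by simp
  then have "((\<lambda>y. f y * sgn (f y)) has_real_derivative d * sgn (f x)) (at x)"
    using f by (auto intro!: derivative_eq_intros)
  then have "((\<lambda>y. \<bar>f y\<bar>) has_real_derivative d * sgn (f x)) (at x)"
    by (simp add: abs_sgn)
  from DERIV_powr[OF this _ DERIV_const[of p]] assms show ?thesis
    by (auto elim!: DERIV_cong simp: sgn_if)
qed

text \<open>The logarithmic derivative of \<open>S\<close> in \<open>t = ln r\<close>, before any equation is used.  As
  \<open>Z\<close> is \<open>-S\<close> with the two functions exchanged and \<^term>\<open>p\<close> replaced by \<^term>\<open>q\<close>, the lemma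
  also gives the derivative of \<open>Z\<close>.\<close>

lemma S_of_has_log_derivative:
  assumes "r > 0" "deriv u1 r \<noteq> 0" "deriv u2 r \<noteq> 0"
    and "deriv u1 differentiable (at r)" "deriv u2 differentiable (at r)"
  shows "((\<lambda>t. S_of p u1 u2 (exp t)) has_real_derivative S_of p u1 u2 r *
      (1 + p * (r * deriv (deriv u2) r / deriv u2 r) - r * deriv (deriv u1) r / deriv u1 r))
    (at (ln r))"
proof -
  have ln: "exp (ln r) = r" using assms by simp
  have D: "((\<lambda>t. deriv u (exp t)) has_real_derivative deriv (deriv u) r * r) (at (ln r))"
    if "deriv u differentiable (at r)" for u
    using DERIV_chain2[of "deriv u" "deriv (deriv u) r" exp "ln r" r UNIV]
      that DERIV_exp[of "ln r"] ln
    by (simp add: DERIV_deriv_iff_real_differentiable)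
  have "((\<lambda>t. \<bar>deriv u2 (exp t)\<bar> powr p) has_real_derivative
      \<bar>deriv u2 r\<bar> powr p * (p * (deriv (deriv u2) r * r / deriv u2 r))) (at (ln r))"
    using has_real_derivative_abs_powr[OF D, of u2 p] assms ln by simp
  then have "((\<lambda>t. \<bar>deriv u2 (exp t)\<bar> powr p / deriv u1 (exp t)) has_real_derivative
      (\<bar>deriv u2 r\<bar> powr p * (p * (deriv (deriv u2) r * r / deriv u2 r)) * deriv u1 r
        - \<bar>deriv u2 r\<bar> powr p * (deriv (deriv u1) r * r)) / (deriv u1 r * deriv u1 r)) (at (ln r))"
    using DERIV_divide[OF _ D[of u1]] assms ln by fastforce
  from DERIV_mult[OF DERIV_exp this] show ?thesis
    unfolding S_of_def by (rule DERIV_cong) (use assms ln in \<open>simp add: field_simps\<close>)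
qed

lemma Z_of_eq_S_of: "Z_of q u1 u2 = (\<lambda>r. - S_of q u2 u1 r)"
  by (auto simp: Z_of_def S_of_def)

text \<open>Write \<open>A = r u1''/u1' + N - 1 + S\<close> and \<open>B = r u2''/u2' + N - 1 - Z\<close>.  The radial system
  says \<open>A = B = 0\<close>, while the system for \<open>S\<close> and \<open>Z\<close> says \<open>p B - A = q A - B = 0\<close>.  This linear
  system has determinant \<open>1 - p q\<close>, and so only the zero solution.\<close>

lemma radial_system_iff_SZ_system:
  assumes r: "r > 0" and nz: "deriv u1 r \<noteq> 0" "deriv u2 r \<noteq> 0"
    and diff: "deriv u1 differentiable (at r)" "deriv u2 differentiable (at r)"
    and pq: "p * q \<noteq> 1"
  shows "radial_system_at N p q u1 u2 r \<longleftrightarrow>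
    SZ_system_at N p q (\<lambda>t. S_of p u1 u2 (exp t)) (\<lambda>t. Z_of q u1 u2 (exp t)) (ln r)"
proof -
  define s where "s = S_of p u1 u2 r"
  define z where "z = Z_of q u1 u2 r"
  define a where "a = r * deriv (deriv u1) r / deriv u1 r"
  define b where "b = r * deriv (deriv u2) r / deriv u2 r"
  define A where "A = a + (real N - 1) + s"
  define B where "B = b + (real N - 1) - z"
  have nz': "s \<noteq> 0" "z \<noteq> 0" using r nz by (auto simp: s_def z_def S_of_def Z_of_def)
  have DS: "((\<lambda>t. S_of p u1 u2 (exp t)) has_real_derivative s * (1 + p * b - a)) (at (ln r))"
    using S_of_has_log_derivative[OF r nz diff] by (simp add: s_def a_def b_def)
  have DZ: "((\<lambda>t. Z_of q u1 u2 (exp t)) has_real_derivative z * (1 + q * a - b)) (at (ln r))"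
    using DERIV_minus[OF S_of_has_log_derivative[OF r nz(2,1) diff(2,1), of q]]
    by (simp add: z_def a_def b_def Z_of_eq_S_of)
  have iff: "(f has_real_derivative d') (at x) \<longleftrightarrow> d = d'"
    if "(f has_real_derivative d) (at x)" for f :: "real \<Rightarrow> real" and d d' x
    using that DERIV_unique by blast
  have "SZ_system_at N p q (\<lambda>t. S_of p u1 u2 (exp t)) (\<lambda>t. Z_of q u1 u2 (exp t)) (ln r) \<longleftrightarrow>
     1 + p * b - a = real N - (real N - 1) * p + s + p * z \<and>
     1 + q * a - b = real N - (real N - 1) * q - q * s - z"
    unfolding SZ_system_at_def iff[OF DS] iff[OF DZ] using r nz'
    by (simp add: s_def[symmetric] z_def[symmetric])
  also have "\<dots> \<longleftrightarrow> A = p * B \<and> B = q * A"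
    by (auto simp: A_def B_def algebra_simps)
  also have "\<dots> \<longleftrightarrow> A = 0 \<and> B = 0"
  proof
    assume *: "A = p * B \<and> B = q * A"
    then have "A = p * (q * A)" by metis
    with pq have "A = 0" by auto
    with * show "A = 0 \<and> B = 0" by simp
  qed auto
  also have "\<dots> \<longleftrightarrow> radial_system_at N p q u1 u2 r"
  proof -
    have A: "A = r / deriv u1 r *
        (deriv (deriv u1) r + (real N - 1) / r * deriv u1 r + \<bar>deriv u2 r\<bar> powr p)"
      using r nz by (simp add: A_def a_def s_def S_of_def field_simps)
    have B: "B = r / deriv u2 r *
        (deriv (deriv u2) r + (real N - 1) / r * deriv u2 r + \<bar>deriv u1 r\<bar> powr q)"
      using r nz by (simp add: B_def b_def z_def Z_of_def field_simps)
    show ?thesis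
      unfolding A B radial_system_at_def mult_eq_0_iff using r nz by auto
  qed
  finally show ?thesis by simp
qed

section \<open>Recovering the derivatives\<close>

text \<open>The symmetry \<open>(S, Z) \<mapsto> (-Z, -S)\<close>; the sign in front of \<^term>\<open>s\<close> is immaterial here.\<close>

lemma du2_of_eq_du1_of: "du2_of p q r s z = du1_of q p r (- z) s"
  by (simp add: du1_of_def du2_of_def mult_ac sgn_minus)

lemma du1_of_uminus: "du1_of p q r s (- z) = du1_of p q r s z"
  by (simp add: du1_of_def)

text \<open>Here \<open>S\<close> and \<open>-Z\<close> stand in place of \<open>S\<close> and \<open>Z\<close>, which makes the lemma serve \<open>u2'\<close> as
  well.  Signs are read off directly, and the moduli are compared through their logarithms, where
  the claim is linear.\<close>

lemma du1_of_recovers: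
  assumes r: "r > 0" and w: "w1 \<noteq> 0" "w2 \<noteq> 0" and pq: "p * q \<noteq> 1"
  shows "du1_of p q r (r * (\<bar>w2\<bar> powr p / w1)) (r * (\<bar>w1\<bar> powr q / w2)) = w1"
proof -
  define \<rho> \<alpha> \<beta> where "\<rho> = ln r" and "\<alpha> = ln \<bar>w1\<bar>" and "\<beta> = ln \<bar>w2\<bar>"
  have e: "r = exp \<rho>" "\<bar>w1\<bar> = exp \<alpha>" "\<bar>w2\<bar> = exp \<beta>"
    using r w by (auto simp: \<rho>_def \<alpha>_def \<beta>_def)
  have "r powr (- (p + 1)) * \<bar>r * (\<bar>w2\<bar> powr p / w1)\<bar> * \<bar>r * (\<bar>w1\<bar> powr q / w2)\<bar> powr p
      = exp (\<alpha> * (p * q - 1))"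
    by (simp add: e abs_mult exp_powr_real algebra_simps flip: exp_add exp_diff)
  then have "du1_of p q r (r * (\<bar>w2\<bar> powr p / w1)) (r * (\<bar>w1\<bar> powr q / w2)) = \<bar>w1\<bar> * sgn w1"
    using r w pq by (simp add: du1_of_def exp_powr_real e sgn_mult sgn_divide)
  then show ?thesis by (simp add: abs_mult_sgn)
qed

text \<open>The moduli \<open>|u1'| = exp x\<close> and \<open>|u2'| = exp y\<close> enter \<open>|S|\<close> through \<open>ln r + p y - x\<close>, and the
  definition of \<open>x\<close> and \<open>y\<close> solves \<open>ln r + p y - x = ln |S|\<close>.\<close>

lemma S_recovered:
  assumes r: "r > 0" and sz: "s \<noteq> 0" "z \<noteq> 0" and pq: "p * q \<noteq> 1"
  shows "r * (\<bar>du2_of p q r s z\<bar> powr p / du1_of p q r s z) = s"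
proof -
  define \<rho> \<alpha> \<beta> where "\<rho> = ln r" and "\<alpha> = ln \<bar>s\<bar>" and "\<beta> = ln \<bar>z\<bar>"
  have e: "r = exp \<rho>" "\<bar>s\<bar> = exp \<alpha>" "\<bar>z\<bar> = exp \<beta>"
    using r sz by (auto simp: \<rho>_def \<alpha>_def \<beta>_def)
  define k where "k = p * q - 1"
  define x where "x = (- (p + 1) * \<rho> + \<alpha> + p * \<beta>) / k"
  define y where "y = (- (q + 1) * \<rho> + q * \<alpha> + \<beta>) / k"
  have w1: "du1_of p q r s z = exp x * sgn s"
    by (simp add: du1_of_def e x_def k_def exp_powr_real mult_ac flip: exp_add)
  have w2: "\<bar>du2_of p q r s z\<bar> = exp y"
    using sz
    by (simp add: du2_of_def abs_mult e y_def k_def exp_powr_real abs_sgn_eq mult_ac flip: exp_add)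
  have k: "k \<noteq> 0" using pq by (simp add: k_def)
  then have "(\<rho> + y * p - x) * k = \<rho> * k + y * k * p - x * k"
    by (simp add: algebra_simps)
  also have "\<dots> = \<alpha> * k"
    using k by (simp add: x_def y_def) (simp add: k_def algebra_simps)
  finally have lin: "\<rho> + y * p - x = \<alpha>" using k by simp
  have "r * (\<bar>du2_of p q r s z\<bar> powr p / \<bar>du1_of p q r s z\<bar>) = exp (\<rho> + y * p - x)"
    unfolding w1 w2 using sz
    by (simp add: abs_mult abs_sgn_eq exp_powr_real e exp_add exp_diff)
  then have "r * (\<bar>du2_of p q r s z\<bar> powr p / \<bar>du1_of p q r s z\<bar>) = \<bar>s\<bar>"
    by (simp only: lin e)
  moreover have "sgn (du1_of p q r s z) = sgn s"
    by (simp add: w1 sgn_mult)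
  ultimately show ?thesis
    by (smt (verit) abs_mult_sgn divide_minus_right mult_minus_right sgn_if sz(1))
qed

lemma Z_recovered:
  assumes r: "r > 0" and sz: "s \<noteq> 0" "z \<noteq> 0" and pq: "p * q \<noteq> 1"
  shows "- r * (\<bar>du1_of p q r s z\<bar> powr q / du2_of p q r s z) = z"
proof -
  have "\<bar>du1_of p q r (- s) z\<bar> = \<bar>du1_of p q r s z\<bar>"
    by (simp add: du1_of_def abs_mult sgn_minus)
  with S_recovered[OF r, of "- z" s q p] assms show ?thesis
    by (simp add: du2_of_eq_du1_of du1_of_uminus mult.commute)
qed

section \<open>Reconstructing a solution from S and Z\<close>

lemma du1_of_differentiable:
  assumes "r > 0" "s r \<noteq> 0" "z r \<noteq> 0"
    and "s differentiable (at r)" "z differentiable (at r)"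
  shows "(\<lambda>\<rho>. du1_of p q \<rho> (s \<rho>) (z \<rho>)) differentiable (at r)"
proof -
  obtain s' z' where D: "(s has_real_derivative s') (at r)" "(z has_real_derivative z') (at r)"
    using assms by (auto simp: real_differentiable_def)
  \<comment> \<open>The exponent 1 and the modulus around the product cast both factors in the form
    \<open>|f| powr c\<close>, differentiable wherever \<open>f\<close> does not vanish.\<close>
  let ?m = "\<lambda>\<rho>. \<rho> powr (- (p + 1)) * \<bar>s \<rho>\<bar> powr 1 * \<bar>z \<rho>\<bar> powr p"
  obtain m' where m: "(?m has_real_derivative m') (at r)"
    using DERIV_mult[OF DERIV_mult[OF has_real_derivative_powr has_real_derivative_abs_powr[OF D(1)]]
      has_real_derivative_abs_powr[OF D(2)]] assms by blast
  obtain k' where k: "((\<lambda>\<rho>. \<bar>?m \<rho>\<bar> powr (1 / (p * q - 1))) has_real_derivative k') (at r)"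
    using has_real_derivative_abs_powr[OF m] assms by auto
  have "((\<lambda>\<rho>. sgn (s \<rho>)) has_real_derivative 0) (at r)"
    using DERIV_chain2[OF has_real_derivative_sgn_nonzero D(1)] assms by simp
  from DERIV_mult[OF k this] show ?thesis
    by (auto simp: du1_of_def real_differentiable_def abs_mult)
qed

text \<open>Extended real endpoints treat bounded and unbounded intervals alike when an antiderivative
  is needed on all of the interval.\<close>

lemma open_interval_eq_einterval:
  fixes I :: "real set"
  assumes "open I" "is_interval I"
  shows "I = einterval (Inf (ereal ` I)) (Sup (ereal ` I))"
proof (intro subset_antisym subsetI)
  fix x assume x: "x \<in> I"
  then obtain e where e: "e > 0" "ball x e \<subseteq> I"
    using \<open>open I\<close> open_contains_ball by blast
  then have "x - e / 2 \<in> I" "x + e / 2 \<in> I"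
    by (auto simp: subset_iff dist_real_def)
  then have "Inf (ereal ` I) \<le> ereal (x - e / 2)" "ereal (x + e / 2) \<le> Sup (ereal ` I)"
    by (auto intro: Inf_lower Sup_upper)
  moreover have "ereal (x - e / 2) < ereal x" "ereal x < ereal (x + e / 2)"
    using e by auto
  ultimately show "x \<in> einterval (Inf (ereal ` I)) (Sup (ereal ` I))"
    unfolding einterval_iff by (meson le_less_trans less_le_trans)
next
  fix x assume "x \<in> einterval (Inf (ereal ` I)) (Sup (ereal ` I))"
  then obtain y z where "y \<in> I" "z \<in> I" "y < x" "x < z"
    by (auto simp: einterval_iff Inf_less_iff less_Sup_iff)
  with \<open>is_interval I\<close> show "x \<in> I"
    by (meson is_interval_1 less_imp_le)
qed

lemma antiderivative_on_open_interval:
  fixes f :: "real \<Rightarrow> real"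
  assumes I: "open I" "is_interval I" and f: "\<And>x. x \<in> I \<Longrightarrow> isCont f x"
  shows "\<exists>F. \<forall>x\<in>I. (F has_real_derivative f x) (at x)"
proof (cases "I = {}")
  case False
  let ?a = "Inf (ereal ` I)" and ?b = "Sup (ereal ` I)"
  have mem: "x \<in> I \<longleftrightarrow> ?a < ereal x \<and> ereal x < ?b" for x
    using open_interval_eq_einterval[OF I] einterval_iff by blast
  obtain x where "x \<in> I" using False by blast
  then have "?a < ?b" unfolding mem by (blast intro: less_trans)
  from einterval_antiderivative[OF this, of f] f show ?thesis
    unfolding Ball_def mem has_real_derivative_iff_has_vector_derivative by blast
qed auto

text \<open>The formulas for \<open>u1'\<close> and \<open>u2'\<close> define differentiable functions on the interval, hence have
  antiderivatives \<^term>\<open>v1\<close> and \<^term>\<open>v2\<close>.  Their \<open>S\<close> and \<open>Z\<close> are the given ones, so the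
  equivalence of the two systems applies.  The radial equations in turn express \<open>v1''\<close> and
  \<open>v2''\<close> through continuous functions, which gives the continuity of these second derivatives.\<close>

lemma SZ_system_reconstruct:
  assumes pq: "p * q \<noteq> 1"
    and I: "open I" "is_interval I" "I \<subseteq> {0<..}"
    and SZ: "\<And>t. t \<in> ln ` I \<Longrightarrow> S t \<noteq> 0 \<and> Z t \<noteq> 0 \<and> SZ_system_at N p q S Z t"
  shows "\<exists>v1 v2. C2_on v1 I \<and> C2_on v2 I \<and>
     (\<forall>r\<in>I. deriv v1 r = du1_of p q r (S (ln r)) (Z (ln r)) \<and>
            deriv v2 r = du2_of p q r (S (ln r)) (Z (ln r)) \<and>
            deriv v1 r \<noteq> 0 \<and> deriv v2 r \<noteq> 0 \<and>
            radial_system_at N p q v1 v2 r \<and>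
            S_of p v1 v2 r = S (ln r) \<and> Z_of q v1 v2 r = Z (ln r))"
proof -
  define w1 where "w1 = (\<lambda>r. du1_of p q r (S (ln r)) (Z (ln r)))"
  define w2 where "w2 = (\<lambda>r. du2_of p q r (S (ln r)) (Z (ln r)))"
  have pos: "r > 0" if "r \<in> I" for r using that I by auto
  have nz: "S (ln r) \<noteq> 0" "Z (ln r) \<noteq> 0" if "r \<in> I" for r using that SZ by auto
  have SZ_diff: "(\<lambda>r. S (ln r)) differentiable (at r)" "(\<lambda>r. - Z (ln r)) differentiable (at r)"
    "(\<lambda>r. Z (ln r)) differentiable (at r)" if r: "r \<in> I" for r
  proof -
    obtain S' Z' where "(S has_real_derivative S') (at (ln r))" "(Z has_real_derivative Z') (at (ln r))"
      using SZ[OF imageI[OF r]] unfolding SZ_system_at_def by blast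
    from this[THEN DERIV_chain2[where g=ln], OF DERIV_ln[OF pos[OF r]]]
    show "(\<lambda>r. S (ln r)) differentiable (at r)" "(\<lambda>r. Z (ln r)) differentiable (at r)"
      by (auto simp: real_differentiable_def)
    then show "(\<lambda>r. - Z (ln r)) differentiable (at r)" by simp
  qed
  have w_diff: "w1 differentiable (at r)" "w2 differentiable (at r)" if "r \<in> I" for r
    unfolding w1_def w2_def du2_of_eq_du1_of
    using that pos nz SZ_diff by (auto intro!: du1_of_differentiable)
  have w_nz: "w1 r \<noteq> 0" "w2 r \<noteq> 0" if "r \<in> I" for r
    using pos[OF that] nz[OF that] by (auto simp: w1_def w2_def du1_of_def du2_of_def sgn_0_0)
  have cont: "isCont w1 r" "isCont w2 r" if "r \<in> I" for r
    using w_diff[OF that] by (auto intro: differentiable_imp_continuous_within)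
  obtain v1 v2 where v: "\<And>r. r \<in> I \<Longrightarrow> (v1 has_real_derivative w1 r) (at r)"
      "\<And>r. r \<in> I \<Longrightarrow> (v2 has_real_derivative w2 r) (at r)"
    using antiderivative_on_open_interval[OF I(1,2)] cont by metis
  have dv: "deriv v1 r = w1 r" "deriv v2 r = w2 r" if "r \<in> I" for r
    using v[OF that] by (auto intro: DERIV_imp_deriv)
  have dv_diff: "deriv v1 differentiable (at r)" "deriv v2 differentiable (at r)" if r: "r \<in> I" for r
  proof -
    obtain d1 d2 where "(w1 has_real_derivative d1) (at r)" "(w2 has_real_derivative d2) (at r)"
      using w_diff[OF r] by (auto simp: real_differentiable_def)
    then have "(deriv v1 has_real_derivative d1) (at r)" "(deriv v2 has_real_derivative d2) (at r)"
      by (auto intro: has_field_derivative_transform_within_open[OF _ I(1) r] simp: dv)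
    then show "deriv v1 differentiable (at r)" "deriv v2 differentiable (at r)"
      by (auto simp: real_differentiable_def)
  qed
  have SZ_of: "S_of p v1 v2 r = S (ln r)" "Z_of q v1 v2 r = Z (ln r)" if "r \<in> I" for r
    using S_recovered[OF pos[OF that] nz[OF that] pq] Z_recovered[OF pos[OF that] nz[OF that] pq]
    by (simp_all add: S_of_def Z_of_def dv[OF that] w1_def w2_def)
  \<comment> \<open>\<open>S\<close> and \<open>Z\<close> are controlled only on \<open>ln I\<close>.  As this set is open, their derivatives
    carry over to the functions built from \<open>v1\<close> and \<open>v2\<close>.\<close>
  have radial: "radial_system_at N p q v1 v2 r" if "r \<in> I" for r
  proof -
    have "open (exp -` I :: real set)" by (intro open_vimage I continuous_intros)
    moreover have "SZ_system_at N p q S Z (ln r)" using SZ that by auto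
    moreover have "exp (ln r) = r" using pos[OF that] by simp
    ultimately have "SZ_system_at N p q (\<lambda>t. S_of p v1 v2 (exp t)) (\<lambda>t. Z_of q v1 v2 (exp t)) (ln r)"
      unfolding SZ_system_at_def using that SZ_of
      by (auto intro: has_field_derivative_transform_within_open[where S="exp -` I"])
    then show ?thesis
      using radial_system_iff_SZ_system pos w_nz dv dv_diff pq that by metis
  qed
  have w_cont: "continuous_on I w1" "continuous_on I w2"
    using cont by (auto intro: continuous_at_imp_continuous_on)
  have C2: "C2_on v1 I" "C2_on v2 I"
  proof -
    have "continuous_on I (\<lambda>r. - ((real N - 1) / r * deriv v1 r) - \<bar>deriv v2 r\<bar> powr p)"
      "continuous_on I (\<lambda>r. - ((real N - 1) / r * deriv v2 r) - \<bar>deriv v1 r\<bar> powr q)"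
      using pos w_nz dv by (auto intro!: continuous_intros w_cont simp: less_imp_neq)
    moreover have "deriv (deriv v1) r = - ((real N - 1) / r * deriv v1 r) - \<bar>deriv v2 r\<bar> powr p"
      "deriv (deriv v2) r = - ((real N - 1) / r * deriv v2 r) - \<bar>deriv v1 r\<bar> powr q"
      if "r \<in> I" for r
      using radial[OF that] by (auto simp: radial_system_at_def)
    ultimately have "continuous_on I (deriv (deriv v1))" "continuous_on I (deriv (deriv v2))"
      by (simp_all cong: continuous_on_cong)
    then show "C2_on v1 I" "C2_on v2 I"
      using v dv_diff by (auto simp: C2_on_def real_differentiable_def)
  qed
  show ?thesis
    using C2 dv w_nz radial SZ_of unfolding w1_def w2_def
    by (intro exI[of _ v1] exI[of _ v2]) auto
qed

section \<open>The equivalence\<close>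

theorem proposition3p6:
  fixes N :: nat and p q :: real and I :: "real set" and u1 u2 :: "real \<Rightarrow> real"
  assumes "N \<ge> 3" and "DIM('a::euclidean_space) = N"
    and "p \<ge> q" and "q > 0" and "p * q > 1"
    and "open I" and "is_interval I" and "I \<subseteq> {0<..}"
    and "C2_on u1 I" and "C2_on u2 I"
  shows
    "(gradient_system p q {x::'a. norm x \<in> I} (\<lambda>x. u1 (norm x)) (\<lambda>x. u2 (norm x))
        \<longleftrightarrow> (\<forall>r\<in>I. radial_system_at N p q u1 u2 r))
     \<and> (\<forall>r\<in>I. deriv u1 r \<noteq> 0 \<and> deriv u2 r \<noteq> 0 \<longrightarrow>
          (radial_system_at N p q u1 u2 r \<longleftrightarrow>
             SZ_system_at N p q (\<lambda>t. S_of p u1 u2 (exp t)) (\<lambda>t. Z_of q u1 u2 (exp t)) (ln r))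
          \<and> deriv u1 r = du1_of p q r (S_of p u1 u2 r) (Z_of q u1 u2 r)
          \<and> deriv u2 r = du2_of p q r (S_of p u1 u2 r) (Z_of q u1 u2 r))
     \<and> (\<forall>S Z. (\<forall>t\<in>ln ` I. S t \<noteq> 0 \<and> Z t \<noteq> 0 \<and> SZ_system_at N p q S Z t) \<longrightarrow>
          (\<exists>v1 v2. C2_on v1 I \<and> C2_on v2 I \<and>
             (\<forall>r\<in>I. deriv v1 r = du1_of p q r (S (ln r)) (Z (ln r)) \<and>
                    deriv v2 r = du2_of p q r (S (ln r)) (Z (ln r)) \<and>
                    deriv v1 r \<noteq> 0 \<and> deriv v2 r \<noteq> 0 \<and>
                    radial_system_at N p q v1 v2 r \<and>
                    S_of p v1 v2 r = S (ln r) \<and> Z_of q v1 v2 r = Z (ln r))))"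
proof (intro conjI)
  have pq: "p * q \<noteq> 1" using assms by simp
  show "gradient_system p q {x::'a. norm x \<in> I} (\<lambda>x. u1 (norm x)) (\<lambda>x. u2 (norm x))
      \<longleftrightarrow> (\<forall>r\<in>I. radial_system_at N p q u1 u2 r)"
    using gradient_system_radial[of I u1 u2 p q, where 'a='a] assms by simp
  show "\<forall>r\<in>I. deriv u1 r \<noteq> 0 \<and> deriv u2 r \<noteq> 0 \<longrightarrow>
          (radial_system_at N p q u1 u2 r \<longleftrightarrow>
             SZ_system_at N p q (\<lambda>t. S_of p u1 u2 (exp t)) (\<lambda>t. Z_of q u1 u2 (exp t)) (ln r))
          \<and> deriv u1 r = du1_of p q r (S_of p u1 u2 r) (Z_of q u1 u2 r)
          \<and> deriv u2 r = du2_of p q r (S_of p u1 u2 r) (Z_of q u1 u2 r)"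
  proof (intro ballI impI conjI; elim conjE)
    fix r assume "r \<in> I" and nz: "deriv u1 r \<noteq> 0" "deriv u2 r \<noteq> 0"
    then have r: "r > 0" and d: "deriv u1 differentiable (at r)" "deriv u2 differentiable (at r)"
      using assms by (auto simp: C2_on_def)
    show "radial_system_at N p q u1 u2 r \<longleftrightarrow>
       SZ_system_at N p q (\<lambda>t. S_of p u1 u2 (exp t)) (\<lambda>t. Z_of q u1 u2 (exp t)) (ln r)"
      using radial_system_iff_SZ_system[OF r nz d pq] .
    show "deriv u1 r = du1_of p q r (S_of p u1 u2 r) (Z_of q u1 u2 r)"
      using du1_of_recovers[OF r nz pq]
      by (simp add: S_of_def Z_of_def du1_of_uminus)
    show "deriv u2 r = du2_of p q r (S_of p u1 u2 r) (Z_of q u1 u2 r)"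
      using du1_of_recovers[OF r nz(2,1), of q p] pq
      by (simp add: du2_of_eq_du1_of S_of_def Z_of_def mult.commute)
  qed
  show "\<forall>S Z. (\<forall>t\<in>ln ` I. S t \<noteq> 0 \<and> Z t \<noteq> 0 \<and> SZ_system_at N p q S Z t) \<longrightarrow>
          (\<exists>v1 v2. C2_on v1 I \<and> C2_on v2 I \<and>
             (\<forall>r\<in>I. deriv v1 r = du1_of p q r (S (ln r)) (Z (ln r)) \<and>
                    deriv v2 r = du2_of p q r (S (ln r)) (Z (ln r)) \<and>
                    deriv v1 r \<noteq> 0 \<and> deriv v2 r \<noteq> 0 \<and>
                    radial_system_at N p q v1 v2 r \<and>
                    S_of p v1 v2 r = S (ln r) \<and> Z_of q v1 v2 r = Z (ln r)))"
    by (intro allI impI, rule SZ_system_reconstruct[OF pq assms(6-8)]) (rule bspec)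
qed

end
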